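(* Let $d$ be a positive integer, let $u=2k\ge4$ be even, and let $s\in[0,1]$. Let $P\subset\mathbb{F}_q^d$ satisfy \[ \sum_{m\in\mathbb{F}_q^d\setminus\{0\}}|\widehat P(m)|^u\le C_0\, q^{-(u-1)d}|P|^{u(1-s)}, \] with $C_0$ depending only on $u$. Let $H$ be a set of hyperplanes in $\mathbb{F}_q^d$ of the form $\{x: a\cdot x=b\}$ with $a\ne0$ and $b\ne0$. Then \[ I(P,H)\le\frac{|P|\,|H|}{q}+C_u\,|H|^{1-\frac1u}q^{\frac{d-1}{u}}|P|^{1-s}, \] where $C_u>0$ depends only on $u$.
   Context: $\chi$ is a fixed nontrivial additive character of $\mathbb{F}_q$ and $\widehat P(m):=q^{-d}\sum_{x\in P}\chi(-m\cdot x)$. $I(P,H)$ is the number of pairs $(x,h)\in P\times H$ with $x\in h$. *)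

theory Defs
  imports Complex_Main "HOL-Algebra.Ring" "HOL-Algebra.Coset" "HOL-Library.FuncSet"
begin

text \<open>
  The constants in the theorem are uniform over all finite fields \<open>F\<close> and all dimensions \<open>d\<close>, so both
  must be quantified inside the scope of an existential quantifier.  Hence fields are \<open>HOL-Algebra\<close>
  records (with \<open>q = order F\<close>) and vectors are extensional functions on \<open>{..<d}\<close>.  Any infinite type, such as
  \<open>nat\<close>, can carry every finite field up to isomorphism.
\<close>

definition vecs :: "('a, 'b) ring_scheme \<Rightarrow> nat \<Rightarrow> (nat \<Rightarrow> 'a) set" where
  "vecs F d = ({..<d} \<rightarrow>\<^sub>E carrier F)"

definition zero_vec :: "('a, 'b) ring_scheme \<Rightarrow> nat \<Rightarrow> nat \<Rightarrow> 'a" where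
  "zero_vec F d = (\<lambda>i\<in>{..<d}. \<zero>\<^bsub>F\<^esub>)"

definition dot :: "('a, 'b) ring_scheme \<Rightarrow> nat \<Rightarrow> (nat \<Rightarrow> 'a) \<Rightarrow> (nat \<Rightarrow> 'a) \<Rightarrow> 'a" where
  "dot F d x y = (\<Oplus>\<^bsub>F\<^esub>i\<in>{..<d}. x i \<otimes>\<^bsub>F\<^esub> y i)"

definition additive_character :: "('a, 'b) ring_scheme \<Rightarrow> ('a \<Rightarrow> complex) \<Rightarrow> bool" where
  "additive_character F \<chi> \<longleftrightarrow>
     (\<forall>x\<in>carrier F. cmod (\<chi> x) = 1) \<and>
     (\<forall>x\<in>carrier F. \<forall>y\<in>carrier F. \<chi> (x \<oplus>\<^bsub>F\<^esub> y) = \<chi> x * \<chi> y)"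

definition nontrivial_additive_character :: "('a, 'b) ring_scheme \<Rightarrow> ('a \<Rightarrow> complex) \<Rightarrow> bool" where
  "nontrivial_additive_character F \<chi> \<longleftrightarrow>
     additive_character F \<chi> \<and> (\<exists>x\<in>carrier F. \<chi> x \<noteq> 1)"

definition fourier ::
  "('a, 'b) ring_scheme \<Rightarrow> nat \<Rightarrow> ('a \<Rightarrow> complex) \<Rightarrow> (nat \<Rightarrow> 'a) set \<Rightarrow> (nat \<Rightarrow> 'a) \<Rightarrow> complex" where
  "fourier F d \<chi> P m = (1 / of_nat (order F) ^ d) * (\<Sum>x\<in>P. \<chi> (\<ominus>\<^bsub>F\<^esub> dot F d m x))"

definition hyperplane ::
  "('a, 'b) ring_scheme \<Rightarrow> nat \<Rightarrow> (nat \<Rightarrow> 'a) \<Rightarrow> 'a \<Rightarrow> (nat \<Rightarrow> 'a) set" where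
  "hyperplane F d a b = {x \<in> vecs F d. dot F d a x = b}"

text \<open>The hyperplanes not passing through the origin.  They are point sets, so proportional
  equations \<open>(a, b)\<close> describe the same hyperplane.\<close>

definition hyperplanes_off_origin ::
  "('a, 'b) ring_scheme \<Rightarrow> nat \<Rightarrow> (nat \<Rightarrow> 'a) set set" where
  "hyperplanes_off_origin F d =
     {hyperplane F d a b | a b.
        a \<in> vecs F d \<and> a \<noteq> zero_vec F d \<and> b \<in> carrier F \<and> b \<noteq> \<zero>\<^bsub>F\<^esub>}"

definition incidences :: "'v set \<Rightarrow> 'v set set \<Rightarrow> nat" where
  "incidences P H = card {(x, h). x \<in> P \<and> h \<in> H \<and> x \<in> h}"

end

theory Submission
  imports Defs "HOL-Algebra.Multiplicative_Group"
begin

text \<open>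
  Every hyperplane off the origin is \<open>{x. a \<bullet> x = 1}\<close> for some \<open>a \<noteq> 0\<close>, and expanding the indicator of
  \<open>a \<bullet> x = 1\<close> in characters bounds the deviation of the number of incidences from \<open>|P||H|/q\<close> by \<open>q\<^sup>d\<^sup>-\<^sup>1\<close> times
  the sum of \<open>|g a|\<close>, where \<open>g a = (\<Sum>t\<noteq>0. \<chi> t * \<P> (t a))\<close> and \<open>\<P>\<close> is the Fourier transform of \<open>P\<close>.
  On each line through the origin, \<open>c \<mapsto> g (c a)\<close> is, up to \<open>c \<mapsto> 1/c\<close>, the one-dimensional Fourier
  transform of \<open>f m = \<P> (m a)\<close>.  The trivial bound by \<open>\<parallel>f\<parallel>\<^sub>1\<close> on \<open>u - 2\<close> factors and Parseval on the two
  others give \<open>(\<Sum>c. |g (c a)|\<^sup>u) \<le> q\<^sup>u\<^sup>-\<^sup>1 (\<Sum>m. |f m|\<^sup>u)\<close>.  Averaging over lines and Hoelder's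
  inequality over \<open>H\<close> finish the proof.
\<close>

section \<open>Power-sum inequalities for real numbers\<close>

text \<open>Expanding the sum of the hypothesis over all pairs \<open>(i, j)\<close> yields twice
  the right-hand side minus twice the left-hand side.\<close>

lemma Chebyshev_sum_similarly_ordered:
  fixes a b :: "'i \<Rightarrow> real"
  assumes "\<And>i j. i \<in> A \<Longrightarrow> j \<in> A \<Longrightarrow> 0 \<le> (a i - a j) * (b i - b j)"
  shows "sum a A * sum b A \<le> real (card A) * (\<Sum>i\<in>A. a i * b i)"
proof -
  have "0 \<le> (\<Sum>i\<in>A. \<Sum>j\<in>A. (a i - a j) * (b i - b j))"
    using assms by (intro sum_nonneg) auto
  also have "\<dots> = (\<Sum>i\<in>A. \<Sum>j\<in>A. a i * b i) + (\<Sum>i\<in>A. \<Sum>j\<in>A. a j * b j)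
      - (\<Sum>i\<in>A. \<Sum>j\<in>A. a i * b j) - (\<Sum>i\<in>A. \<Sum>j\<in>A. a j * b i)"
    by (simp add: algebra_simps sum.distrib sum_subtractf)
  also have "(\<Sum>i\<in>A. \<Sum>j\<in>A. a j * b i) = (\<Sum>i\<in>A. \<Sum>j\<in>A. a i * b j)"
    by (rule sum.swap)
  also have "(\<Sum>i\<in>A. \<Sum>j\<in>A. a i * b j) = sum a A * sum b A"
    by (simp add: sum_product)
  finally show ?thesis
    by (simp add: sum_distrib_left[symmetric])
qed

text \<open>For nonnegative \<open>a\<close>, the families \<open>a i\<close> and
  \<open>a i ^ j\<close> are similarly ordered, so Chebyshev's inequality absorbs one factor
  \<open>sum a A\<close> into the power sum at the cost of a factor \<open>card A\<close>; this is
  repeated \<open>k\<close> times. The case \<open>j = 2\<close> serves the estimate on a line, and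
  \<open>j = 1\<close> replaces Hoelder's inequality over \<open>H\<close>.\<close>

lemma sum_power_mult_sum_le:
  fixes a :: "'i \<Rightarrow> real"
  assumes "\<And>i. i \<in> A \<Longrightarrow> 0 \<le> a i"
  shows "sum a A ^ k * (\<Sum>i\<in>A. a i ^ j) \<le> real (card A) ^ k * (\<Sum>i\<in>A. a i ^ (k + j))"
proof (induction k arbitrary: j)
  case (Suc k)
  have "0 \<le> (a x - a y) * (a x ^ j - a y ^ j)" if "x \<in> A" "y \<in> A" for x y
  proof (cases "a x \<le> a y")
    case True
    thus ?thesis
      using power_mono[OF True assms[OF that(1)], of j] by (intro mult_nonpos_nonpos) auto
  next
    case False
    thus ?thesis
      using power_mono[OF _ assms[OF that(2)], of "a x" j] by (intro mult_nonneg_nonneg) auto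
  qed
  hence *: "sum a A * (\<Sum>i\<in>A. a i ^ j) \<le> real (card A) * (\<Sum>i\<in>A. a i ^ Suc j)"
    using Chebyshev_sum_similarly_ordered[of A a "\<lambda>i. a i ^ j"] by simp
  have "sum a A ^ Suc k * (\<Sum>i\<in>A. a i ^ j) = sum a A ^ k * (sum a A * (\<Sum>i\<in>A. a i ^ j))"
    by (simp add: algebra_simps)
  also have "\<dots> \<le> sum a A ^ k * (real (card A) * (\<Sum>i\<in>A. a i ^ Suc j))"
    using * assms by (intro mult_left_mono zero_le_power sum_nonneg) auto
  also have "\<dots> = real (card A) * (sum a A ^ k * (\<Sum>i\<in>A. a i ^ Suc j))"
    by (simp add: algebra_simps)
  also have "\<dots> \<le> real (card A) * (real (card A) ^ k * (\<Sum>i\<in>A. a i ^ (k + Suc j)))"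
    by (intro mult_left_mono Suc.IH) auto
  finally show ?case by (simp add: algebra_simps)
qed auto

section \<open>Scalar multiples and additive characters\<close>

definition scale :: "('a, 'b) ring_scheme \<Rightarrow> nat \<Rightarrow> 'a \<Rightarrow> (nat \<Rightarrow> 'a) \<Rightarrow> nat \<Rightarrow> 'a" where
  "scale F d c x = (\<lambda>i\<in>{..<d}. c \<otimes>\<^bsub>F\<^esub> x i)"

text \<open>The estimates below are stated for one field and one character, but their constants do
  not depend on these; the locale can therefore be interpreted under the quantifiers of the
  theorem.\<close>

locale finite_field_character = field F for F (structure) +
  fixes \<chi> :: "'a \<Rightarrow> complex"
  assumes fin: "finite (carrier F)"
    and nontrivial: "nontrivial_additive_character F \<chi>"
begin

abbreviation nonzero_vecs :: "nat \<Rightarrow> (nat \<Rightarrow> 'a) set" where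
  "nonzero_vecs d \<equiv> vecs F d - {zero_vec F d}"

abbreviation nonzero_scalars :: "'a set" where
  "nonzero_scalars \<equiv> carrier F - {\<zero>}"

lemma order_pos: "0 < order F"
  using fin by (auto simp: order_def card_gt_0_iff)

lemma card_nonzero_scalars: "card nonzero_scalars = order F - 1"
  using fin by (simp add: order_def)

lemma card_nonzero_scalars_pos: "0 < card nonzero_scalars"
  using fin one_not_zero one_closed unfolding card_gt_0_iff by blast

lemma norm_character: "x \<in> carrier F \<Longrightarrow> cmod (\<chi> x) = 1"
  using nontrivial by (simp add: nontrivial_additive_character_def additive_character_def)

lemma character_add: "x \<in> carrier F \<Longrightarrow> y \<in> carrier F \<Longrightarrow> \<chi> (x \<oplus> y) = \<chi> x * \<chi> y"
  using nontrivial by (simp add: nontrivial_additive_character_def additive_character_def)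

lemma character_zero [simp]: "\<chi> \<zero> = 1"
  using norm_character[of \<zero>] character_add[of \<zero> \<zero>] by auto

lemma character_minus: "x \<in> carrier F \<Longrightarrow> \<chi> (\<ominus> x) = cnj (\<chi> x)"
proof -
  assume x: "x \<in> carrier F"
  have "\<chi> x * \<chi> (\<ominus> x) = \<chi> x * cnj (\<chi> x)"
    using x character_add[of x "\<ominus> x"] norm_character[OF x]
    by (simp add: r_neg complex_norm_square[symmetric])
  thus ?thesis
    using norm_character[OF x] by auto
qed

text \<open>Translation by some \<open>z\<close> with \<open>\<chi> z \<noteq> 1\<close> permutes
  the field and multiplies the sum by \<open>\<chi> z\<close>.\<close>

lemma sum_character: "(\<Sum>x\<in>carrier F. \<chi> x) = 0"
proof -
  obtain z where z: "z \<in> carrier F" "\<chi> z \<noteq> 1"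
    using nontrivial by (auto simp: nontrivial_additive_character_def)
  have "(\<Sum>x\<in>carrier F. \<chi> x) = (\<Sum>x\<in>carrier F. \<chi> (z \<oplus> x))"
    using z
    by (intro sum.reindex_bij_witness[of _ "\<lambda>x. z \<oplus> x" "\<lambda>x. \<ominus> z \<oplus> x"])
      (auto simp: r_neg1 r_neg2)
  also have "\<dots> = \<chi> z * (\<Sum>x\<in>carrier F. \<chi> x)"
    using z by (simp add: character_add sum_distrib_left)
  finally show ?thesis
    using z by auto
qed

lemma sum_nonzero_scalars_mult:
  assumes c: "c \<in> nonzero_scalars"
  shows "(\<Sum>t\<in>nonzero_scalars. \<phi> (t \<otimes> c)) = (\<Sum>t\<in>nonzero_scalars. \<phi> t)"
proof -
  have c': "c \<in> Units F" "inv c \<in> carrier F" "inv c \<noteq> \<zero>" "c \<in> carrier F" "c \<noteq> \<zero>"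
    using c field_Units by (auto intro: Units_inv_closed dest: Units_inv_Units)
  show ?thesis
    by (intro sum.reindex_bij_witness[of _ "\<lambda>t. t \<otimes> inv c" "\<lambda>t. t \<otimes> c"])
      (use c' in \<open>auto simp: m_assoc Units_r_inv Units_l_inv integral_iff\<close>)
qed

text \<open>Multiplication by a nonzero \<open>x\<close> permutes the nonzero scalars, which reduces
  the sum to the full character sum. This is the detector of \<open>x = \<zero>\<close> behind both
  Parseval and the incidence count.\<close>

lemma sum_character_mult:
  assumes "x \<in> carrier F"
  shows "(\<Sum>t\<in>carrier F. \<chi> (t \<otimes> x)) = (if x = \<zero> then of_nat (order F) else 0)"
proof (cases "x = \<zero>")
  case False
  have "(\<Sum>t\<in>carrier F. \<chi> (t \<otimes> x)) = 1 + (\<Sum>t\<in>nonzero_scalars. \<chi> (t \<otimes> x))"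
    using fin assms by (subst sum.remove[of _ \<zero>]) auto
  also have "\<dots> = 1 + (\<Sum>t\<in>nonzero_scalars. \<chi> t)"
    using assms False sum_nonzero_scalars_mult[of x \<chi>] by simp
  also have "\<dots> = (\<Sum>t\<in>carrier F. \<chi> t)"
    using fin by (subst (2) sum.remove[of _ \<zero>]) auto
  finally show ?thesis
    using False sum_character by simp
qed (auto simp: order_def)

text \<open>The squares expand into pairs \<open>m\<close>, \<open>n\<close>, and summing
  \<open>\<chi> (y \<otimes> (m \<ominus> n))\<close> over all \<open>y\<close> leaves only the
  diagonal. A proper subset \<open>S\<close> amounts to extending \<open>f\<close> by zero.\<close>

lemma Parseval_character:
  assumes S: "S \<subseteq> carrier F"
  shows "(\<Sum>y\<in>carrier F. (cmod (\<Sum>m\<in>S. \<chi> (y \<otimes> m) * f m))\<^sup>2)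
           = real (order F) * (\<Sum>m\<in>S. (cmod (f m))\<^sup>2)"
proof -
  have finS: "finite S" using S fin finite_subset by blast
  have orth: "(\<Sum>y\<in>carrier F. \<chi> (y \<otimes> m) * cnj (\<chi> (y \<otimes> n)))
      = (if n = m then of_nat (order F) else 0)"
    if "m \<in> S" "n \<in> S" for m n
  proof -
    have mn: "m \<in> carrier F" "n \<in> carrier F" using that S by auto
    have "(\<Sum>y\<in>carrier F. \<chi> (y \<otimes> m) * cnj (\<chi> (y \<otimes> n))) = (\<Sum>y\<in>carrier F. \<chi> (y \<otimes> (m \<ominus> n)))"
      using mn by (intro sum.cong refl)
        (simp add: minus_eq r_distr character_add r_minus character_minus)
    also have "\<dots> = (if n = m then of_nat (order F) else 0)"
      using mn by (subst sum_character_mult) auto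
    finally show ?thesis .
  qed
  \<comment> \<open>The identity is proved over the complex numbers, where a squared modulus is a
    product with the conjugate.\<close>
  have "complex_of_real (\<Sum>y\<in>carrier F. (cmod (\<Sum>m\<in>S. \<chi> (y \<otimes> m) * f m))\<^sup>2)
      = (\<Sum>y\<in>carrier F. \<Sum>m\<in>S. \<Sum>n\<in>S. (\<chi> (y \<otimes> m) * f m) * (cnj (\<chi> (y \<otimes> n)) * cnj (f n)))"
    unfolding of_real_sum complex_norm_square by (simp add: sum_product)
  also have "\<dots> = (\<Sum>m\<in>S. \<Sum>y\<in>carrier F. \<Sum>n\<in>S. (\<chi> (y \<otimes> m) * f m) * (cnj (\<chi> (y \<otimes> n)) * cnj (f n)))"
    by (rule sum.swap)
  also have "\<dots> = (\<Sum>m\<in>S. \<Sum>n\<in>S. \<Sum>y\<in>carrier F. (\<chi> (y \<otimes> m) * f m) * (cnj (\<chi> (y \<otimes> n)) * cnj (f n)))"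
    by (intro sum.cong refl sum.swap)
  also have "\<dots> = (\<Sum>m\<in>S. \<Sum>n\<in>S. f m * cnj (f n) * (\<Sum>y\<in>carrier F. \<chi> (y \<otimes> m) * cnj (\<chi> (y \<otimes> n))))"
    by (simp add: sum_distrib_left mult_ac)
  also have "\<dots> = (\<Sum>m\<in>S. \<Sum>n\<in>S. if n = m then f m * cnj (f m) * of_nat (order F) else 0)"
    by (intro sum.cong refl) (simp add: orth)
  also have "\<dots> = (\<Sum>m\<in>S. f m * cnj (f m) * of_nat (order F))"
    using finS by simp
  also have "\<dots> = complex_of_real (real (order F) * (\<Sum>m\<in>S. (cmod (f m))\<^sup>2))"
    by (simp add: complex_norm_square sum_distrib_left mult_ac del: of_real_power)
  finally show ?thesis
    using of_real_eq_iff by blast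
qed

lemma sum_norm_character_sum_power_le:
  fixes f :: "'a \<Rightarrow> complex"
  assumes u: "2 \<le> u"
  shows "(\<Sum>c\<in>nonzero_scalars. cmod (\<Sum>m\<in>nonzero_scalars. \<chi> (c \<otimes> m) * f m) ^ u)
           \<le> real (order F) ^ (u - 1) * (\<Sum>m\<in>nonzero_scalars. cmod (f m) ^ u)"
proof -
  define G where "G c = cmod (\<Sum>m\<in>nonzero_scalars. \<chi> (c \<otimes> m) * f m)" for c
  define L where "L = (\<Sum>m\<in>nonzero_scalars. cmod (f m))"
  obtain k where k: "u = k + 2" using u by (metis add.commute le_iff_add)
  have G_le: "G c \<le> L" if "c \<in> carrier F" for c
    unfolding G_def L_def
    by (rule order_trans[OF norm_sum]) (use that in \<open>auto simp: norm_mult norm_character\<close>)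
  have L_nonneg: "0 \<le> L" unfolding L_def by (intro sum_nonneg) auto
  \<comment> \<open>The term \<open>c = \<zero>\<close> is added because Parseval sums over the
    whole field.\<close>
  have "(\<Sum>c\<in>nonzero_scalars. G c ^ u) \<le> (\<Sum>c\<in>carrier F. G c ^ u)"
    using fin by (intro sum_mono2) (auto simp: G_def)
  also have "\<dots> \<le> (\<Sum>c\<in>carrier F. L ^ k * (G c)\<^sup>2)"
    unfolding k power_add
    by (intro sum_mono mult_right_mono power_mono G_le) (auto simp: G_def)
  also have "\<dots> = L ^ k * (real (order F) * (\<Sum>m\<in>nonzero_scalars. (cmod (f m))\<^sup>2))"
    unfolding sum_distrib_left[symmetric] G_def by (subst Parseval_character) auto
  also have "\<dots> = real (order F) * (L ^ k * (\<Sum>m\<in>nonzero_scalars. (cmod (f m))\<^sup>2))"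
    by simp
  \<comment> \<open>The power-sum inequality moves \<open>L ^ k\<close> into the sum of
    \<open>u\<close>-th powers. Its \<open>k = u - 2\<close> factors, each at most
    \<open>order F\<close>, and the one from Parseval make up the exponent
    \<open>u - 1\<close>.\<close>
  also have "\<dots> \<le> real (order F) *
      (real (card nonzero_scalars) ^ k * (\<Sum>m\<in>nonzero_scalars. cmod (f m) ^ (k + 2)))"
    unfolding L_def by (intro mult_left_mono sum_power_mult_sum_le) auto
  also have "\<dots> \<le> real (order F) *
      (real (order F) ^ k * (\<Sum>m\<in>nonzero_scalars. cmod (f m) ^ (k + 2)))"
    unfolding card_nonzero_scalars
    by (intro mult_left_mono mult_right_mono power_mono sum_nonneg) auto
  finally show ?thesis
    by (simp add: G_def k mult_ac)
qed

section \<open>Dilations of vectors and hyperplanes off the origin\<close>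

lemma finite_vecs [simp]: "finite (vecs F d)"
  using fin by (simp add: vecs_def finite_PiE)

lemma vecs_component: "x \<in> vecs F d \<Longrightarrow> i < d \<Longrightarrow> x i \<in> carrier F"
  by (auto simp: vecs_def)

lemma dot_closed: "x \<in> vecs F d \<Longrightarrow> y \<in> vecs F d \<Longrightarrow> dot F d x y \<in> carrier F"
  unfolding dot_def by (intro finsum_closed) (auto simp: vecs_component)

lemma scale_in_vecs: "c \<in> carrier F \<Longrightarrow> x \<in> vecs F d \<Longrightarrow> scale F d c x \<in> vecs F d"
  by (auto simp: scale_def vecs_def PiE_iff)

lemma dot_scale:
  assumes "c \<in> carrier F" "x \<in> vecs F d" "y \<in> vecs F d"
  shows "dot F d (scale F d c x) y = c \<otimes> dot F d x y"
proof -
  have "dot F d (scale F d c x) y = (\<Oplus>i\<in>{..<d}. c \<otimes> (x i \<otimes> y i))"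
    unfolding dot_def using assms
    by (intro finsum_cong') (auto simp: scale_def m_assoc vecs_component)
  also have "\<dots> = c \<otimes> dot F d x y"
    unfolding dot_def using assms by (subst finsum_rdistr) (auto simp: vecs_component)
  finally show ?thesis .
qed

lemma scale_scale:
  assumes "c \<in> carrier F" "e \<in> carrier F" "x \<in> vecs F d"
  shows "scale F d c (scale F d e x) = scale F d (c \<otimes> e) x"
  using assms by (auto simp: scale_def m_assoc vecs_component restrict_def)

lemma scale_one: "x \<in> vecs F d \<Longrightarrow> scale F d \<one> x = x"
  by (auto simp: scale_def vecs_def PiE_iff extensional_def)

lemma scale_zero_right: "c \<in> carrier F \<Longrightarrow> scale F d c (zero_vec F d) = zero_vec F d"
  by (auto simp: scale_def zero_vec_def)

lemma inverse_nonzero_scalar: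
  assumes "c \<in> nonzero_scalars"
  shows "inv c \<in> nonzero_scalars" "c \<otimes> inv c = \<one>" "inv c \<otimes> c = \<one>"
  using assms field_Units Units_inv_Units[of c] Units_r_inv[of c] Units_l_inv[of c] by auto

lemma scale_nonzero:
  assumes c: "c \<in> nonzero_scalars" and x: "x \<in> nonzero_vecs d"
  shows "scale F d c x \<in> nonzero_vecs d"
proof -
  have "x = zero_vec F d" if "scale F d c x = zero_vec F d"
  proof -
    have "x = scale F d (inv c) (scale F d c x)"
      using c x inverse_nonzero_scalar[OF c] by (simp add: scale_scale scale_one)
    thus ?thesis
      using that inverse_nonzero_scalar[OF c] by (simp add: scale_zero_right)
  qed
  thus ?thesis using c x by (auto simp: scale_in_vecs)
qed

lemma sum_nonzero_vecs_scale:
  assumes c: "c \<in> nonzero_scalars"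
  shows "(\<Sum>a\<in>nonzero_vecs d. \<phi> (scale F d c a)) = (\<Sum>a\<in>nonzero_vecs d. \<phi> a)"
proof (intro sum.reindex_bij_witness[of _ "scale F d (inv c)" "scale F d c"])
  fix a assume a: "a \<in> nonzero_vecs d"
  note ic = inverse_nonzero_scalar[OF c]
  show "scale F d (inv c) (scale F d c a) = a" "scale F d c (scale F d (inv c) a) = a"
    using a c ic by (simp_all add: scale_scale scale_one)
  show "scale F d c a \<in> nonzero_vecs d" "scale F d (inv c) a \<in> nonzero_vecs d"
    using a c ic by (auto intro!: scale_nonzero simp del: Diff_iff)
qed simp

text \<open>Dividing the equation by \<open>b \<noteq> \<zero>\<close> replaces the normal
  \<open>a\<close> by its multiple by \<open>inv b\<close>. Sums over hyperplanes thus become sums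
  over nonzero vectors.\<close>

lemma hyperplanes_off_origin_subset:
  "hyperplanes_off_origin F d \<subseteq> (\<lambda>a. hyperplane F d a \<one>) ` nonzero_vecs d"
proof
  fix h assume "h \<in> hyperplanes_off_origin F d"
  then obtain a b where ab: "a \<in> nonzero_vecs d" "b \<in> nonzero_scalars" "h = hyperplane F d a b"
    by (auto simp: hyperplanes_off_origin_def)
  note ib = inverse_nonzero_scalar[OF ab(2)]
  have "inv b \<otimes> y = \<one> \<longleftrightarrow> y = b" if "y \<in> carrier F" for y
  proof
    assume "inv b \<otimes> y = \<one>"
    moreover have "b \<otimes> inv b \<otimes> y = b \<otimes> (inv b \<otimes> y)"
      using that ib(1) ab(2) by (intro m_assoc) auto
    ultimately show "y = b" using that ib(2) ab(2) by simp
  qed (use ib in simp)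
  hence "h = hyperplane F d (scale F d (inv b) a) \<one>"
    using ab ib by (auto simp: hyperplane_def dot_scale dot_closed)
  thus "h \<in> (\<lambda>a. hyperplane F d a \<one>) ` nonzero_vecs d"
    using scale_nonzero[OF ib(1) ab(1)] by blast
qed

section \<open>Sums of the Fourier transform along lines\<close>

text \<open>The function \<open>g\<close> of the overview: for nonzero \<open>a\<close> and up to
  the factor \<open>q^(d-1)\<close>, the contribution of the nonzero frequencies to
  \<open>card (P \<inter> hyperplane F d a \<one>)\<close>.\<close>

definition line_sum :: "nat \<Rightarrow> (nat \<Rightarrow> 'a) set \<Rightarrow> (nat \<Rightarrow> 'a) \<Rightarrow> complex" where
  "line_sum d P a = (\<Sum>t\<in>nonzero_scalars. \<chi> t * fourier F d \<chi> P (scale F d t a))"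

lemma sum_line_sum_power_le:
  assumes u: "2 \<le> u"
  shows "(\<Sum>a\<in>nonzero_vecs d. cmod (line_sum d P a) ^ u)
    \<le> real (order F) ^ (u - 1) * (\<Sum>a\<in>nonzero_vecs d. cmod (fourier F d \<chi> P a) ^ u)"
    (is "?L \<le> _ * ?S")
proof -
  let ?N = "real (card nonzero_scalars)"
  let ?f = "\<lambda>a. fourier F d \<chi> P a"
  have on_line: "(\<Sum>c\<in>nonzero_scalars. cmod (line_sum d P (scale F d c a)) ^ u)
      \<le> real (order F) ^ (u - 1) * (\<Sum>c\<in>nonzero_scalars. cmod (?f (scale F d c a)) ^ u)"
    if a: "a \<in> nonzero_vecs d" for a
  proof -
    define g where "g c = cmod (\<Sum>m\<in>nonzero_scalars. \<chi> (c \<otimes> m) * ?f (scale F d m a)) ^ u" for c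
    have "line_sum d P (scale F d c a)
        = (\<Sum>m\<in>nonzero_scalars. \<chi> (inv c \<otimes> m) * ?f (scale F d m a))"
      if c: "c \<in> nonzero_scalars" for c
    proof -
      note ic = inverse_nonzero_scalar[OF c]
      \<comment> \<open>Prepares the substitution \<open>m = t \<otimes> c\<close>, under which
        \<open>t\<close> becomes \<open>inv c \<otimes> m\<close>.\<close>
      have "line_sum d P (scale F d c a)
          = (\<Sum>t\<in>nonzero_scalars. \<chi> (inv c \<otimes> (t \<otimes> c)) * ?f (scale F d (t \<otimes> c) a))"
        unfolding line_sum_def
      proof (intro sum.cong refl arg_cong2[of _ _ _ _ "(*)"])
        fix t assume t: "t \<in> nonzero_scalars"
        have "inv c \<otimes> (t \<otimes> c) = t \<otimes> (inv c \<otimes> c)"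
          using t c ic(1) by (simp add: m_lcomm)
        thus "\<chi> t = \<chi> (inv c \<otimes> (t \<otimes> c))"
          using t ic by simp
        show "?f (scale F d t (scale F d c a)) = ?f (scale F d (t \<otimes> c) a)"
          using t c a by (simp add: scale_scale)
      qed
      also have "\<dots> = (\<Sum>m\<in>nonzero_scalars. \<chi> (inv c \<otimes> m) * ?f (scale F d m a))"
        by (rule sum_nonzero_scalars_mult[OF c])
      finally show ?thesis .
    qed
    hence "(\<Sum>c\<in>nonzero_scalars. cmod (line_sum d P (scale F d c a)) ^ u)
        = (\<Sum>c\<in>nonzero_scalars. g (inv c))"
      by (intro sum.cong refl) (simp add: g_def)
    also have "\<dots> = (\<Sum>c\<in>nonzero_scalars. g c)"
      using inverse_nonzero_scalar field_Units Units_inv_inv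
      by (intro sum.reindex_bij_witness[of _ "\<lambda>c. inv c" "\<lambda>c. inv c"]) auto
    also have "\<dots> \<le> real (order F) ^ (u - 1) * (\<Sum>c\<in>nonzero_scalars. cmod (?f (scale F d c a)) ^ u)"
      unfolding g_def by (rule sum_norm_character_sum_power_le[OF u])
    finally show ?thesis .
  qed
  \<comment> \<open>Each dilation permutes the nonzero vectors, so after swapping the sums all
    \<open>card nonzero_scalars\<close> inner sums agree. Averaging in this way avoids choosing a
    representative on every line.\<close>
  have average: "?N * (\<Sum>a\<in>nonzero_vecs d. \<phi> a)
      = (\<Sum>a\<in>nonzero_vecs d. \<Sum>c\<in>nonzero_scalars. \<phi> (scale F d c a))" for \<phi> :: "_ \<Rightarrow> real"
    by (subst sum.swap) (simp add: sum_nonzero_vecs_scale)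
  have "?N * ?L \<le> (\<Sum>a\<in>nonzero_vecs d. real (order F) ^ (u - 1) *
      (\<Sum>c\<in>nonzero_scalars. cmod (?f (scale F d c a)) ^ u))"
    unfolding average by (intro sum_mono on_line)
  also have "\<dots> = ?N * (real (order F) ^ (u - 1) * ?S)"
    unfolding sum_distrib_left[symmetric] average[of "\<lambda>a. cmod (?f a) ^ u", symmetric]
    by (simp only: mult_ac)
  finally show ?thesis
    using card_nonzero_scalars_pos by simp
qed

section \<open>Counting incidences by characters\<close>

text \<open>Summing \<open>\<chi> (t \<otimes> (\<one> \<ominus> dot F d a x))\<close> over
  \<open>t\<close> gives \<open>q\<close> on the hyperplane and zero elsewhere. After division by
  \<open>q\<close>, the term \<open>t = \<zero>\<close> is the expected count \<open>|P| / q\<close>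
  and the other terms form \<open>line_sum\<close>.\<close>

lemma card_inter_hyperplane:
  assumes P: "P \<subseteq> vecs F d" and a: "a \<in> vecs F d"
  shows "of_nat (card (P \<inter> hyperplane F d a \<one>))
    = of_nat (card P) / of_nat (order F)
      + of_nat (order F) ^ d / of_nat (order F) * line_sum d P a"
proof -
  let ?q = "of_nat (order F) :: complex"
  have finP: "finite P" using P finite_subset[OF _ finite_vecs] by blast
  have q: "?q \<noteq> 0" using order_pos by simp
  have "?q * of_nat (card (P \<inter> hyperplane F d a \<one>))
      = (\<Sum>x\<in>P. if dot F d a x = \<one> then ?q else 0)"
  proof -
    have "P \<inter> hyperplane F d a \<one> = {x \<in> P. dot F d a x = \<one>}"
      using P by (auto simp: hyperplane_def)
    thus ?thesis using finP by (simp add: sum.If_cases Int_def)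
  qed
  also have "\<dots> = (\<Sum>x\<in>P. \<Sum>t\<in>carrier F. \<chi> (t \<otimes> (\<one> \<ominus> dot F d a x)))"
    using P a dot_closed by (intro sum.cong refl) (auto simp: sum_character_mult subset_iff)
  also have "\<dots> = (\<Sum>t\<in>carrier F. \<Sum>x\<in>P. \<chi> t * \<chi> (\<ominus> dot F d (scale F d t a) x))"
  proof (subst sum.swap, intro sum.cong refl)
    fix t x assume tx: "t \<in> carrier F" "x \<in> P"
    hence D: "dot F d a x \<in> carrier F" using P a dot_closed by auto
    have "t \<otimes> (\<one> \<ominus> dot F d a x) = t \<oplus> \<ominus> dot F d (scale F d t a) x"
      using tx P a D by (subst dot_scale) (auto simp: minus_eq r_distr r_minus)
    thus "\<chi> (t \<otimes> (\<one> \<ominus> dot F d a x)) = \<chi> t * \<chi> (\<ominus> dot F d (scale F d t a) x)"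
      using tx P a D by (subst character_add[symmetric]) (auto simp: dot_scale subset_iff)
  qed
  also have "\<dots> = (\<Sum>x\<in>P. \<chi> \<zero> * \<chi> (\<ominus> dot F d (scale F d \<zero> a) x))
      + (\<Sum>t\<in>nonzero_scalars. \<Sum>x\<in>P. \<chi> t * \<chi> (\<ominus> dot F d (scale F d t a) x))"
    using fin by (subst sum.remove[of _ \<zero>]) auto
  also have "(\<Sum>x\<in>P. \<chi> \<zero> * \<chi> (\<ominus> dot F d (scale F d \<zero> a) x)) = (\<Sum>x\<in>P. 1)"
    using P a dot_closed by (intro sum.cong refl) (auto simp: dot_scale subset_iff)
  also have "\<dots> = of_nat (card P)" by simp
  \<comment> \<open>The factor \<open>?q ^ d\<close> undoes the normalisation in
    \<open>fourier\<close>.\<close>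
  also have "(\<Sum>t\<in>nonzero_scalars. \<Sum>x\<in>P. \<chi> t * \<chi> (\<ominus> dot F d (scale F d t a) x))
      = ?q ^ d * line_sum d P a"
    using q unfolding line_sum_def fourier_def by (simp add: sum_distrib_left field_simps)
  finally show ?thesis using q by (simp add: field_simps)
qed

text \<open>Injectivity lets the hyperplanes be counted by their normals; the triangle inequality is
  then applied to the exact count on each hyperplane.\<close>

lemma incidences_le_sum_line_sum:
  assumes P: "P \<subseteq> vecs F d" and A: "A \<subseteq> vecs F d"
    and inj: "inj_on (\<lambda>a. hyperplane F d a \<one>) A"
  shows "real (incidences P ((\<lambda>a. hyperplane F d a \<one>) ` A))
    \<le> real (card P) * real (card A) / real (order F)
      + real (order F) ^ d / real (order F) * (\<Sum>a\<in>A. cmod (line_sum d P a))"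
proof -
  let ?h = "\<lambda>a. hyperplane F d a \<one>"
  have fins: "finite P" "finite A" using P A finite_subset[OF _ finite_vecs] by blast+
  have "{(x, h). x \<in> P \<and> h \<in> ?h ` A \<and> x \<in> h} = prod.swap ` (SIGMA h:?h ` A. P \<inter> h)"
    by auto
  hence "incidences P (?h ` A) = card (SIGMA h:?h ` A. P \<inter> h)"
    by (simp add: incidences_def card_image)
  also have "\<dots> = (\<Sum>a\<in>A. card (P \<inter> ?h a))"
    using fins inj by (simp add: card_SigmaI sum.reindex)
  finally have "incidences P (?h ` A) = (\<Sum>a\<in>A. card (P \<inter> ?h a))" .
  hence "real (incidences P (?h ` A)) = (\<Sum>a\<in>A. real (card (P \<inter> ?h a)))" by simp
  also have "\<dots> \<le> (\<Sum>a\<in>A. real (card P) / real (order F)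
      + real (order F) ^ d / real (order F) * cmod (line_sum d P a))"
  proof (intro sum_mono)
    fix a assume "a \<in> A"
    hence a: "a \<in> vecs F d" using A by auto
    have "real (card (P \<inter> ?h a)) = cmod (of_nat (card (P \<inter> ?h a)))" by simp
    also have "\<dots> \<le> cmod (of_nat (card P) / of_nat (order F))
        + cmod (of_nat (order F) ^ d / of_nat (order F) * line_sum d P a)"
      unfolding card_inter_hyperplane[OF P a] by (rule norm_triangle_ineq)
    finally show "real (card (P \<inter> ?h a)) \<le> real (card P) / real (order F)
        + real (order F) ^ d / real (order F) * cmod (line_sum d P a)"
      by (simp add: norm_mult norm_divide norm_power)
  qed
  finally show ?thesis
    by (simp add: sum.distrib sum_distrib_left mult_ac)
qed

section \<open>The incidence bound over a single field\<close>

text \<open>Here \<open>r\<close> stands for \<open>1 - s\<close>. The error term and the claimed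
  bound \<open>R\<close> are compared through their \<open>u\<close>-th powers, so that no root is
  taken before the last step.\<close>

lemma incidences_le:
  fixes C :: real
  assumes u: "2 \<le> u" and C: "1 \<le> C"
    and P: "P \<subseteq> vecs F d"
    and S: "(\<Sum>m\<in>nonzero_vecs d. cmod (fourier F d \<chi> P m) ^ u)
      \<le> C * real (order F) powr (- ((real u - 1) * real d)) * real (card P) powr (real u * r)"
    and H: "H \<subseteq> hyperplanes_off_origin F d"
  shows "real (incidences P H)
    \<le> real (card P) * real (card H) / real (order F)
      + C * real (card H) powr (1 - 1 / real u) * real (order F) powr ((real d - 1) / real u)
          * real (card P) powr r"
proof -
  let ?q = "real (order F)"
  have q: "0 < ?q" using order_pos by simp
  \<comment> \<open>\<open>A\<close> contains exactly one normal for each hyperplane in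
    \<open>H\<close>.\<close>
  obtain A where A: "A \<subseteq> nonzero_vecs d" "inj_on (\<lambda>a. hyperplane F d a \<one>) A"
    and HA: "H = (\<lambda>a. hyperplane F d a \<one>) ` A"
    using subset_trans[OF H hyperplanes_off_origin_subset] unfolding subset_image_inj by blast
  have cardH: "card H = card A" using A HA by (simp add: card_image)
  define X where "X = (\<Sum>a\<in>A. cmod (line_sum d P a))"
  have X0: "0 \<le> X" unfolding X_def by (intro sum_nonneg) auto
  define R where "R = C * real (card H) powr (1 - 1 / real u) * ?q powr ((real d - 1) / real u)
          * real (card P) powr r"
  have R0: "0 \<le> R" unfolding R_def using C by simp
  \<comment> \<open>At \<open>x = 0\<close> both sides vanish, since \<open>0 powr b = 0\<close> for
    every \<open>b\<close>, even \<open>b = 0\<close>, and \<open>u > 0\<close>. This covers empty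
    \<open>P\<close> and empty \<open>H\<close>.\<close>
  have pw: "(x powr b) ^ u = x powr (b * real u)" if "0 \<le> x" for x b :: real
    using that u by (cases "x = 0") (auto simp: powr_realpow[symmetric] powr_powr)
  have X_le: "X ^ u \<le> real (card H) powr (real u - 1) * (?q ^ (u - 1) *
      (C * ?q powr (- ((real u - 1) * real d)) * real (card P) powr (real u * r)))"
  proof -
    \<comment> \<open>One factor \<open>X\<close> is set aside as the power sum with
      \<open>j = 1\<close>, so that the power-sum inequality with \<open>k = u - 1\<close> acts as
      Hoelder's inequality.\<close>
    have "X ^ u = X ^ (u - 1) * (\<Sum>a\<in>A. cmod (line_sum d P a) ^ 1)"
      using u unfolding X_def by (cases u) auto
    also have "\<dots> \<le> real (card A) ^ (u - 1) * (\<Sum>a\<in>A. cmod (line_sum d P a) ^ (u - 1 + 1))"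
      unfolding X_def by (intro sum_power_mult_sum_le) auto
    also have "\<dots> \<le> real (card A) ^ (u - 1) * (\<Sum>a\<in>nonzero_vecs d. cmod (line_sum d P a) ^ u)"
      using A u by (intro mult_left_mono) (auto intro!: sum_mono2)
    also have "\<dots> \<le> real (card A) ^ (u - 1) * (?q ^ (u - 1) *
        (\<Sum>a\<in>nonzero_vecs d. cmod (fourier F d \<chi> P a) ^ u))"
      by (intro mult_left_mono sum_line_sum_power_le[OF u]) auto
    also have "\<dots> \<le> real (card A) ^ (u - 1) * (?q ^ (u - 1) *
        (C * ?q powr (- ((real u - 1) * real d)) * real (card P) powr (real u * r)))"
      by (intro mult_left_mono S) auto
    \<comment> \<open>For empty \<open>A\<close> both sides are zero, as
      \<open>u - 1 > 0\<close>.\<close>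
    also have "real (card A) ^ (u - 1) = real (card H) powr (real u - 1)"
      using u by (cases "card A = 0") (auto simp: cardH powr_realpow[symmetric] of_nat_diff)
    finally show ?thesis .
  qed
  \<comment> \<open>The exponents of \<open>q\<close> add up to
    \<open>u(d-1) + (u-1) - (u-1)d = d - 1\<close>.\<close>
  have exponents: "(?q ^ d / ?q) ^ u * (?q ^ (u - 1) * ?q powr (- ((real u - 1) * real d)))
      = ?q powr (real d - 1)"
  proof -
    have "?q ^ d / ?q = ?q powr (real d - 1)"
      using q by (simp add: powr_diff powr_realpow)
    moreover have "?q ^ (u - 1) = ?q powr (real u - 1)"
      using q u by (simp add: powr_realpow[symmetric] of_nat_diff)
    ultimately show ?thesis
      using q by (simp add: pw powr_add[symmetric]) (simp add: algebra_simps)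
  qed
  have "(?q ^ d / ?q * X) ^ u \<le> (?q ^ d / ?q) ^ u * (real (card H) powr (real u - 1) * (?q ^ (u - 1) *
      (C * ?q powr (- ((real u - 1) * real d)) * real (card P) powr (real u * r))))"
    unfolding power_mult_distrib by (intro mult_left_mono X_le) auto
  also have "\<dots> = C * (real (card H) powr (real u - 1)
      * ((?q ^ d / ?q) ^ u * (?q ^ (u - 1) * ?q powr (- ((real u - 1) * real d))))
      * real (card P) powr (real u * r))"
    by (simp only: mult_ac)
  also have "\<dots> = C * (real (card H) powr (real u - 1) * ?q powr (real d - 1)
      * real (card P) powr (real u * r))"
    unfolding exponents ..
  \<comment> \<open>From \<open>1 \<le> C\<close> follows \<open>C \<le> C ^ u\<close>, so
    \<open>R\<close> may carry \<open>C\<close> itself instead of its \<open>u\<close>-th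
    root.\<close>
  also have "\<dots> \<le> C ^ u * (real (card H) powr (real u - 1) * ?q powr (real d - 1)
      * real (card P) powr (real u * r))"
    using C u self_le_power[of C u] by (intro mult_right_mono) auto
  also have "\<dots> = R ^ u"
  proof -
    have "(1 - 1 / real u) * real u = real u - 1" "(real d - 1) / real u * real u = real d - 1"
      using u by (simp_all add: field_simps)
    thus ?thesis
      unfolding R_def power_mult_distrib by (simp add: pw mult_ac)
  qed
  finally have "?q ^ d / ?q * X \<le> R"
    using R0 u power_mono_iff[of "?q ^ d / ?q * X" R u] X0 by simp
  moreover have "real (incidences P H)
      \<le> real (card P) * real (card H) / ?q + ?q ^ d / ?q * X"
    unfolding X_def cardH unfolding HA using A P
    by (intro incidences_le_sum_line_sum) auto
  ultimately show ?thesis unfolding R_def by linarith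
qed

end

theorem theorem4p3:
  fixes u :: nat and C\<^sub>0 :: real
  assumes "even u" and "u \<ge> 4"
  shows "\<exists>C\<^sub>u > 0. \<forall>(F :: 'a ring) (d :: nat) (\<chi> :: 'a \<Rightarrow> complex) (s :: real)
            (P :: (nat \<Rightarrow> 'a) set) (H :: (nat \<Rightarrow> 'a) set set).
       field F \<longrightarrow> finite (carrier F) \<longrightarrow> d > 0 \<longrightarrow>
       nontrivial_additive_character F \<chi> \<longrightarrow>
       0 \<le> s \<longrightarrow> s \<le> 1 \<longrightarrow>
       P \<subseteq> vecs F d \<longrightarrow>
       (\<Sum>m\<in>vecs F d - {zero_vec F d}. cmod (fourier F d \<chi> P m) ^ u)
         \<le> C\<^sub>0 * real (order F) powr (- ((real u - 1) * real d))
              * real (card P) powr (real u * (1 - s)) \<longrightarrow>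
       H \<subseteq> hyperplanes_off_origin F d \<longrightarrow>
       real (incidences P H)
         \<le> real (card P) * real (card H) / real (order F)
           + C\<^sub>u * real (card H) powr (1 - 1 / real u)
               * real (order F) powr ((real d - 1) / real u)
               * real (card P) powr (1 - s)"
proof (intro exI[of _ "max 1 C\<^sub>0"] conjI allI impI)
  fix F :: "'a ring" and d :: nat and \<chi> :: "'a \<Rightarrow> complex" and s :: real
    and P :: "(nat \<Rightarrow> 'a) set" and H :: "(nat \<Rightarrow> 'a) set set"
  assume F: "field F" "finite (carrier F)" "nontrivial_additive_character F \<chi>"
    and P: "P \<subseteq> vecs F d" and H: "H \<subseteq> hyperplanes_off_origin F d"
    and S: "(\<Sum>m\<in>vecs F d - {zero_vec F d}. cmod (fourier F d \<chi> P m) ^ u)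
         \<le> C\<^sub>0 * real (order F) powr (- ((real u - 1) * real d))
              * real (card P) powr (real u * (1 - s))"
  interpret finite_field_character F \<chi>
    using F by (simp add: finite_field_character_def finite_field_character_axioms_def)
  \<comment> \<open>The bound \<open>incidences_le\<close> asks for a constant of at least 1, so
    \<open>C\<^sub>0\<close> is enlarged to \<open>max 1 C\<^sub>0\<close>. This witness is also
    positive and is fixed before the field, the dimension and the character.\<close>
  note S
  also have "C\<^sub>0 * real (order F) powr (- ((real u - 1) * real d))
        * real (card P) powr (real u * (1 - s))
      \<le> max 1 C\<^sub>0 * real (order F) powr (- ((real u - 1) * real d))
        * real (card P) powr (real u * (1 - s))"
    by (intro mult_right_mono) auto
  finally show "real (incidences P H)
         \<le> real (card P) * real (card H) / real (order F)
           + max 1 C\<^sub>0 * real (card H) powr (1 - 1 / real u)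
               * real (order F) powr ((real d - 1) / real u)
               * real (card P) powr (1 - s)"
    using assms by (intro incidences_le P H) auto
qed simp

end
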